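(* Let $1\le p<\infty$. Let $L=P(\partial/\partial x_1,\dots,\partial/\partial x_n)$ be a weakly hypoelliptic differential operator on $\mathbb{R}^n$ with constant coefficients in $N'\times N$-matrices (acting on functions $\mathbb{R}^n\to\mathbb{R}^N$), and suppose $L$ is weighted homogeneous. Then \[ \mathcal{H}(\mathbb{R}^n,L)\cap L^p(\mathbb{R}^n,\mathbb{R}^N)=\{0\}. \]
   Context: A polynomial $P$ in $n$ real variables with matrix coefficients is weighted homogeneous with weight $w=(w_1,\dots,w_n)$, $w_j>0$, if there is $k$ such that $P(t^{w_1}x_1,\dots,t^{w_n}x_n)=t^kP(x_1,\dots,x_n)$ for all $t>0$ and $x\in\mathbb{R}^n$; the operator $P(\partial/\partial x)$ is then called weighted homogeneous. $L$ is weakly hypoelliptic if for every open $\Omega\subset\mathbb{R}^n$, every distributional solution $u\in\mathcal{D}'(\Omega,\mathbb{R}^N)$ of $Lu=0$ is smooth. $\mathcal{H}(\mathbb{R}^n,L)\subset C^\infty(\mathbb{R}^n,\mathbb{R}^N)$ denotes the space of distributional solutions of $Lu=0$ on $\mathbb{R}^n$. *)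

theory Defs
  imports "HOL-Analysis.Analysis"
begin

primrec Dlist :: "'n::finite list \<Rightarrow> (real^'n \<Rightarrow> real) \<Rightarrow> real^'n \<Rightarrow> real" where
  "Dlist [] f = f"
| "Dlist (i # is) f = (\<lambda>x. frechet_derivative (Dlist is f) (at x) (axis i 1))"

definition smooth_on :: "(real^'n::finite) set \<Rightarrow> (real^'n \<Rightarrow> real) \<Rightarrow> bool" where
  "smooth_on S f \<longleftrightarrow> (\<forall>xs. Dlist xs f differentiable_on S)"

definition tsupp :: "(real^'n::finite \<Rightarrow> real) \<Rightarrow> (real^'n) set" where
  "tsupp \<phi> = closure {x. \<phi> x \<noteq> 0}"

definition test_fun :: "(real^'n::finite) set \<Rightarrow> (real^'n \<Rightarrow> real) \<Rightarrow> bool" where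
  "test_fun \<Omega> \<phi> \<longleftrightarrow> smooth_on UNIV \<phi> \<and> compact (tsupp \<phi>) \<and> tsupp \<phi> \<subseteq> \<Omega>"

definition is_distribution ::
  "(real^'n::finite) set \<Rightarrow> ((real^'n \<Rightarrow> real) \<Rightarrow> real) \<Rightarrow> bool" where
  "is_distribution \<Omega> T \<longleftrightarrow>
     (\<forall>\<phi> \<psi> c. test_fun \<Omega> \<phi> \<longrightarrow> test_fun \<Omega> \<psi> \<longrightarrow>
        T (\<lambda>x. \<phi> x + \<psi> x) = T \<phi> + T \<psi> \<and> T (\<lambda>x. c * \<phi> x) = c * T \<phi>) \<and>
     (\<forall>K. compact K \<and> K \<subseteq> \<Omega> \<longrightarrow>
        (\<exists>C m. \<forall>\<phi>. test_fun \<Omega> \<phi> \<and> tsupp \<phi> \<subseteq> K \<longrightarrow>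
           \<bar>T \<phi>\<bar> \<le> C * (\<Sum>xs\<in>{xs :: 'n list. length xs \<le> m}. SUP x. \<bar>Dlist xs \<phi> x\<bar>)))"

definition vdist ::
  "(real^'n::finite) set \<Rightarrow> ('N \<Rightarrow> (real^'n \<Rightarrow> real) \<Rightarrow> real) \<Rightarrow> bool" where
  "vdist \<Omega> u \<longleftrightarrow> (\<forall>j. is_distribution \<Omega> (u j))"

text \<open>A list of directions realising the multi-index alpha (order irrelevant for smooth functions).\<close>
definition mlist :: "('n::finite \<Rightarrow> nat) \<Rightarrow> 'n list" where
  "mlist \<alpha> = (SOME xs. \<forall>i. count_list xs i = \<alpha> i)"

text \<open>A constant-coefficient operator P(d/dx) = sum_alpha A_alpha d^alpha with N'xN matrix
  coefficients is given by its coefficient function A, of finite support.\<close>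
definition diff_op :: "(('n::finite \<Rightarrow> nat) \<Rightarrow> real^'N::finite^'M::finite) \<Rightarrow> bool" where
  "diff_op A \<longleftrightarrow> finite {\<alpha>. A \<alpha> \<noteq> 0}"

definition symbol :: "(('n::finite \<Rightarrow> nat) \<Rightarrow> real^'N::finite^'M::finite) \<Rightarrow> real^'n \<Rightarrow> real^'N^'M" where
  "symbol A \<xi> = (\<Sum>\<alpha>\<in>{\<alpha>. A \<alpha> \<noteq> 0}. (\<Prod>i\<in>UNIV. (\<xi> $ i) ^ (\<alpha> i)) *\<^sub>R A \<alpha>)"

definition weighted_homogeneous :: "(('n::finite \<Rightarrow> nat) \<Rightarrow> real^'N::finite^'M::finite) \<Rightarrow> bool" where
  "weighted_homogeneous A \<longleftrightarrow>
     (\<exists>(w :: real^'n) (k :: real). (\<forall>i. w $ i > 0) \<and>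
        (\<forall>t>0. \<forall>x. symbol A (\<chi> i. t powr (w $ i) * x $ i) = t powr k *\<^sub>R symbol A x))"

definition dist_apply ::
  "(('n::finite \<Rightarrow> nat) \<Rightarrow> real^'N::finite^'M::finite) \<Rightarrow> ('N \<Rightarrow> (real^'n \<Rightarrow> real) \<Rightarrow> real)
     \<Rightarrow> 'M \<Rightarrow> (real^'n \<Rightarrow> real) \<Rightarrow> real" where
  "dist_apply A u k \<phi> =
     (\<Sum>\<alpha>\<in>{\<alpha>. A \<alpha> \<noteq> 0}. \<Sum>j\<in>UNIV.
        (A \<alpha> $ k $ j) * (-1) ^ (sum \<alpha> UNIV) * u j (Dlist (mlist \<alpha>) \<phi>))"

definition dist_solution ::
  "(real^'n::finite) set \<Rightarrow> (('n \<Rightarrow> nat) \<Rightarrow> real^'N::finite^'M::finite)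
     \<Rightarrow> ('N \<Rightarrow> (real^'n \<Rightarrow> real) \<Rightarrow> real) \<Rightarrow> bool" where
  "dist_solution \<Omega> A u \<longleftrightarrow> vdist \<Omega> u \<and> (\<forall>k \<phi>. test_fun \<Omega> \<phi> \<longrightarrow> dist_apply A u k \<phi> = 0)"

definition reg_dist :: "(real^'n::finite \<Rightarrow> real^'N) \<Rightarrow> 'N \<Rightarrow> (real^'n \<Rightarrow> real) \<Rightarrow> real" where
  "reg_dist f j \<phi> = (LINT x|lborel. (f x $ j) * \<phi> x)"

definition weakly_hypoelliptic :: "(('n::finite \<Rightarrow> nat) \<Rightarrow> real^'N::finite^'M::finite) \<Rightarrow> bool" where
  "weakly_hypoelliptic A \<longleftrightarrow>
     (\<forall>\<Omega>. open \<Omega> \<longrightarrow> (\<forall>u. dist_solution \<Omega> A u \<longrightarrow>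
        (\<exists>f :: real^'n \<Rightarrow> real^'N. (\<forall>j. smooth_on \<Omega> (\<lambda>x. f x $ j)) \<and>
            (\<forall>j \<phi>. test_fun \<Omega> \<phi> \<longrightarrow> u j \<phi> = reg_dist f j \<phi>))))"

definition sol_space :: "(('n::finite \<Rightarrow> nat) \<Rightarrow> real^'N::finite^'M::finite) \<Rightarrow> (real^'n \<Rightarrow> real^'N) set" where
  "sol_space A = {f. (\<forall>j. smooth_on UNIV (\<lambda>x. f x $ j)) \<and> dist_solution UNIV A (reg_dist f)}"

definition Lp_fun :: "real \<Rightarrow> (real^'n::finite \<Rightarrow> real^'N::finite) \<Rightarrow> bool" where
  "Lp_fun p f \<longleftrightarrow> f \<in> borel_measurable lborel \<and> integrable lborel (\<lambda>x. norm (f x) powr p)"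

end

(* The dilation E x = (a_i x_i) with a_i = 2^(w_i) preserves solutions, and the L^1 norm of u o E^m
   over a compact set decays geometrically in m when u is in L^p. Hence G = sum_m (u o E^m) converges
   to a distribution solving L G = 0, so G is represented by a smooth function f. Since
   f - f o E = u weakly and E fixes the origin, u 0 = 0. Translates of u satisfy the same
   hypotheses, so u vanishes everywhere. *)
theory Submission
  imports Defs
begin

subsection \<open>Diagonal affine maps\<close>

text \<open>Weak hypoellipticity is qualitative: it supplies a smooth representative but no
  estimate, and \<open>u\<close> is smooth already. It has to be applied to a solution whose
  smoothness is not evident. Each term of G takes the value \<open>u 0\<close> at the origin, so a
  representative of G that is continuous there is incompatible with \<open>u 0\<close> being
  nonzero. The geometric rate comes from the Jacobian: with s the product of the a_i, the integral
  of |u o E^m|^p is s^(-m) times that of |u|^p, and passing to L^1 on a compact set leaves the ratio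
  s^(-1/p), which is below 1 because p is finite. Homogeneity is given for the symbol as a function,
  whereas the derivatives of a dilated test function scale multi-index by multi-index. Independence
  of monomials bridges this: a^\<alpha> takes one common value \<kappa> over all \<alpha> with
  nonzero coefficient. Dilations and translations are treated together as diagonal affine maps, so
  the same invariance lemma serves both.\<close>

definition dil :: "('n \<Rightarrow> real) \<Rightarrow> real^'n \<Rightarrow> real^'n \<Rightarrow> real^'n::finite" where
  "dil c b x = (\<chi> i. c i * x $ i + b $ i)"

lemma has_derivative_dil: "(dil c b has_derivative (\<lambda>h. \<chi> i. c i * h $ i)) (at x within S)"
proof -
  have "linear (\<lambda>h. \<chi> i. c i * h $ i)"
    by (intro linearI) (auto simp: vec_eq_iff algebra_simps)
  from has_derivative_add_const[OF linear_imp_has_derivative[OF this], of b] show ?thesis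
    by (simp add: dil_def[abs_def] plus_vec_def)
qed

lemma continuous_on_dil: "continuous_on S (dil c b)"
  by (meson has_derivative_dil has_derivative_continuous_on)

lemma smooth_onD: "smooth_on UNIV f \<Longrightarrow> Dlist xs f differentiable at x"
  unfolding smooth_on_def differentiable_on_def by auto

lemma Dlist_append: "Dlist (xs @ ys) f = Dlist xs (Dlist ys f)"
  by (induction xs) auto

lemma smooth_on_Dlist: "smooth_on S f \<Longrightarrow> smooth_on S (Dlist xs f)"
  unfolding smooth_on_def by (metis Dlist_append)

lemma smooth_on_continuous: "smooth_on S f \<Longrightarrow> continuous_on S f"
  unfolding smooth_on_def by (metis Dlist.simps(1) differentiable_imp_continuous_on)

text \<open>The linear part is diagonal, so the chain rule sends each axis direction to a multiple
  of itself: partial derivatives do not mix, and each one contributes a single scalar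
  factor.\<close>

lemma Dlist_dil:
  assumes "smooth_on UNIV \<phi>"
  shows "Dlist xs (\<lambda>x. \<phi> (dil c b x)) = (\<lambda>x. prod_list (map c xs) * Dlist xs \<phi> (dil c b x))"
proof (induction xs)
  case (Cons i xs)
  show ?case
  proof
    fix x
    define D where "D = frechet_derivative (Dlist xs \<phi>) (at (dil c b x))"
    have D: "(Dlist xs \<phi> has_derivative D) (at (dil c b x))"
      unfolding D_def using assms frechet_derivative_works smooth_onD by blast
    have "((\<lambda>x. Dlist xs \<phi> (dil c b x)) has_derivative (\<lambda>h. D (\<chi> i. c i * h $ i))) (at x)"
      using diff_chain_at[OF has_derivative_dil D] by (simp add: o_def)
    then have "((\<lambda>x. prod_list (map c xs) * Dlist xs \<phi> (dil c b x))
        has_derivative (\<lambda>h. prod_list (map c xs) * D (\<chi> i. c i * h $ i))) (at x)"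
      by (rule has_derivative_mult_right)
    then have "Dlist (i # xs) (\<lambda>x. \<phi> (dil c b x)) x = prod_list (map c xs) * D (\<chi> j. c j * axis i 1 $ j)"
      using Cons by (simp add: frechet_derivative_at[symmetric])
    also have "(\<chi> j. c j * axis i 1 $ j) = c i *\<^sub>R axis i (1::real)"
      by (auto simp: vec_eq_iff axis_def)
    also have "D \<dots> = c i * D (axis i 1)"
      using D has_derivative_linear linear_scale by fastforce
    finally show "Dlist (i # xs) (\<lambda>x. \<phi> (dil c b x)) x
        = prod_list (map c (i # xs)) * Dlist (i # xs) \<phi> (dil c b x)"
      by (simp add: D_def)
  qed
qed simp

lemma smooth_on_dil:
  assumes "smooth_on UNIV \<phi>"
  shows "smooth_on UNIV (\<lambda>x. \<phi> (dil c b x))"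
  unfolding smooth_on_def Dlist_dil[OF assms] differentiable_on_def
proof (intro allI ballI)
  fix xs x
  have "(Dlist xs \<phi> \<circ> dil c b) differentiable at x"
    by (rule differentiable_chain_at[OF differentiableI[OF has_derivative_dil] smooth_onD[OF assms]])
  then show "(\<lambda>x. prod_list (map c xs) * Dlist xs \<phi> (dil c b x)) differentiable at x"
    by (simp add: o_def)
qed

lemma dil_inverse:
  assumes "\<And>i. c i \<noteq> 0"
  shows "dil (\<lambda>i. inverse (c i)) (\<chi> i. - (b $ i / c i)) (dil c b x) = x"
    "dil c b (dil (\<lambda>i. inverse (c i)) (\<chi> i. - (b $ i / c i)) x) = x"
  using assms by (auto simp: dil_def vec_eq_iff field_simps)

lemma tsupp_dil_subset:
  "tsupp (\<lambda>x. \<phi> (dil c b x)) \<subseteq> dil c b -` tsupp \<phi>"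
  unfolding tsupp_def
  by (rule closure_minimal)
    (auto intro: closed_vimage continuous_on_dil closure_subset[THEN subsetD])

lemma test_fun_dil:
  assumes "test_fun UNIV \<phi>" "\<And>i. c i \<noteq> 0"
  shows "test_fun UNIV (\<lambda>x. \<phi> (dil c b x))"
proof -
  let ?d = "dil (\<lambda>i. inverse (c i)) (\<chi> i. - (b $ i / c i))"
  \<comment> \<open>Writing the preimage inside an image under the inverse map lets compactness pass
    to it.\<close>
  have sub: "dil c b -` tsupp \<phi> \<subseteq> ?d ` tsupp \<phi>"
    using dil_inverse(1)[of c b, OF assms(2)] by (auto simp: image_iff) metis
  have "compact (?d ` tsupp \<phi>)"
    using assms(1) unfolding test_fun_def
    by (intro compact_continuous_image continuous_on_dil) auto
  then have "bounded (tsupp (\<lambda>x. \<phi> (dil c b x)))"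
    by (rule bounded_subset[OF compact_imp_bounded order.trans[OF tsupp_dil_subset sub]])
  then have "compact (tsupp (\<lambda>x. \<phi> (dil c b x)))"
    by (auto simp: compact_eq_bounded_closed tsupp_def)
  then show ?thesis using assms(1) smooth_on_dil by (auto simp: test_fun_def)
qed

text \<open>Ensures that the choice in \<open>mlist\<close> picks a list that really has the
  prescribed multiplicities.\<close>

lemma ex_count_list: "\<exists>xs. \<forall>i. count_list xs i = (\<alpha> :: 'n::finite \<Rightarrow> nat) i"
proof -
  obtain xs where "mset xs = (\<Sum>i\<in>UNIV. replicate_mset (\<alpha> i) i)" using ex_mset by blast
  then have "count_list xs j = \<alpha> j" for j
    by (simp add: count_mset[symmetric] count_sum if_distrib sum.delta cong: if_cong)
  then show ?thesis by blast
qed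

lemma prod_list_map_mlist: "prod_list (map c (mlist \<alpha>)) = (\<Prod>i\<in>UNIV. c i ^ \<alpha> i)"
  for c :: "'n::finite \<Rightarrow> real"
proof -
  have "prod_list (map c xs) = (\<Prod>i\<in>UNIV. c i ^ count_list xs i)" for xs
  proof (induction xs)
    case (Cons j xs)
    have "(\<Prod>i\<in>UNIV. c i ^ count_list (j # xs) i)
        = (\<Prod>i\<in>UNIV. (if j = i then c i else 1) * c i ^ count_list xs i)"
      by (rule prod.cong) auto
    also have "\<dots> = c j * (\<Prod>i\<in>UNIV. c i ^ count_list xs i)"
      by (simp add: prod.distrib)
    finally show ?case using Cons by simp
  qed simp
  moreover have "\<forall>i. count_list (mlist \<alpha>) i = \<alpha> i"
    unfolding mlist_def using ex_count_list by (rule someI_ex)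
  ultimately show ?thesis by simp
qed

section \<open>Lebesgue measure under diagonal affine maps\<close>

lemma lborel_dil:
  fixes c :: "'n::finite \<Rightarrow> real"
  assumes "\<And>i. c i > 0"
  shows "lborel = density (distr lborel borel (dil c b)) (\<lambda>_. ennreal (\<Prod>i\<in>UNIV. c i))"
proof -
  \<comment> \<open>\<open>lborel_affine_euclidean\<close> indexes its factors by basis vectors; the
    choice recovers the coordinate from its axis vector.\<close>
  let ?c = "\<lambda>j :: real^'n. c (SOME i. j = axis i 1)"
  have sc: "?c (axis i 1) = c i" for i
    by (simp add: axis_eq_axis)
  have bas: "Basis = (\<lambda>i. axis i (1::real)) ` (UNIV::'n set)"
    by (auto simp: Basis_vec_def)
  have inj: "inj (\<lambda>i::'n. axis i (1::real))"
    by (auto simp: inj_on_def axis_eq_axis)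
  have "(\<Sum>j\<in>Basis. (?c j * (x \<bullet> j)) *\<^sub>R j) = (\<Sum>i\<in>UNIV. (c i * x $ i) *\<^sub>R axis i 1)" for x
    unfolding bas sum.reindex[OF inj] by (simp add: o_def sc inner_axis)
  moreover have "(\<Sum>i\<in>UNIV. (c i * x $ i) *\<^sub>R axis i 1) = (\<chi> i. c i * x $ i)" for x :: "real^'n"
    by (simp add: vec_eq_iff axis_def if_distrib sum.delta cong: if_cong)
  ultimately have T: "(\<lambda>x. b + (\<Sum>j\<in>Basis. (?c j * (x \<bullet> j)) *\<^sub>R j)) = dil c b"
    by (auto simp: dil_def vec_eq_iff)
  have P: "(\<Prod>j\<in>Basis. \<bar>?c j\<bar>) = (\<Prod>i\<in>UNIV. c i)"
    unfolding bas prod.reindex[OF inj] using assms by (simp add: o_def sc abs_of_pos)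
  have "\<And>j. j \<in> Basis \<Longrightarrow> ?c j \<noteq> 0"
    using assms by (metis less_irrefl)
  from lborel_affine_euclidean[of ?c b, OF this] show ?thesis
    unfolding T P .
qed

lemma
  fixes c :: "'n::finite \<Rightarrow> real" and g :: "real^'n \<Rightarrow> real"
  assumes c: "\<And>i. c i > 0" and [measurable]: "g \<in> borel_measurable borel"
  shows integral_dil: "(LINT x|lborel. g (dil c b x)) = (LINT x|lborel. g x) / (\<Prod>i\<in>UNIV. c i)"
    and integrable_dil_iff: "integrable lborel (\<lambda>x. g (dil c b x)) \<longleftrightarrow> integrable lborel g"
proof -
  have [measurable]: "dil c b \<in> borel_measurable borel"
    by (intro borel_measurable_continuous_onI continuous_on_dil)
  have P: "(\<Prod>i\<in>UNIV. c i) > 0" using c by (simp add: prod_pos)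
  show "(LINT x|lborel. g (dil c b x)) = (LINT x|lborel. g x) / (\<Prod>i\<in>UNIV. c i)"
    using P by (subst (2) lborel_dil[of c b, OF c]) (simp add: integral_density integral_distr less_imp_neq[symmetric] del: prod_zero_iff)
  show "integrable lborel (\<lambda>x. g (dil c b x)) \<longleftrightarrow> integrable lborel g"
    using P by (subst (2) lborel_dil[of c b, OF c]) (simp add: integrable_density integrable_distr_eq less_imp_neq[symmetric] del: prod_zero_iff)
qed

subsection \<open>Bump functions\<close>

text \<open>For k = 0 this is the classical function exp(-1/t), flat at 0. The powers of 1/t make
  the linear span of the family closed under differentiation.\<close>

definition exp_recip :: "nat \<Rightarrow> real \<Rightarrow> real" where
  "exp_recip k t = (if t > 0 then exp (- (1 / t)) / t ^ k else 0)"

lemma exp_recip_tendsto_0: "(exp_recip k \<longlongrightarrow> 0) (at 0)"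
proof (rule filterlim_split_at)
  have "eventually (\<lambda>t. exp_recip k t = 0) (at_left (0::real))"
    by (auto simp: exp_recip_def eventually_at_filter)
  then show "(exp_recip k \<longlongrightarrow> 0) (at_left 0)"
    by (rule tendsto_eventually)
  have "((\<lambda>t. inverse t ^ k / exp (inverse t)) \<longlongrightarrow> (0::real)) (at_right 0)"
    using tendsto_power_div_exp_0 filterlim_inverse_at_top_right by (rule filterlim_compose)
  moreover have "eventually (\<lambda>t. inverse t ^ k / exp (inverse t) = exp_recip k t) (at_right (0::real))"
    by (auto simp: exp_recip_def eventually_at_filter exp_minus field_simps)
  ultimately show "(exp_recip k \<longlongrightarrow> 0) (at_right 0)"
    by (rule Lim_transform_eventually)
qed

lemma exp_recip_has_derivative:
  "(exp_recip k has_real_derivative (exp_recip (k + 2) t - k * exp_recip (k + 1) t)) (at t)"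
proof -
  consider "t > 0" | "t < 0" | "t = 0" by linarith
  then show ?thesis
  proof cases
    case 1
    have e: "real k * t ^ (k - Suc 0) = real k * t ^ k / t"
      using 1 by (cases k) auto
    have alg: "(E * (1 / t\<^sup>2) * P - E * (real k * P / t)) / (P * P)
        = E / (P * t\<^sup>2) - real k * (E / (P * t))" if "P > 0" for E P
    proof -
      have "(E * (1 / t\<^sup>2) * P - E * (real k * P / t)) / (P * P) = (E / t\<^sup>2 - E * real k / t) / P"
        using 1 that by (simp add: diff_divide_distrib)
      also have "\<dots> = E / (P * t\<^sup>2) - real k * (E / (P * t))"
        using 1 that by (simp add: diff_divide_distrib mult_ac)
      finally show ?thesis .
    qed
    have "((\<lambda>t. exp (- (1 / t)) / t ^ k) has_real_derivative
        (exp (- (1 / t)) * (1 / t\<^sup>2) * t ^ k - exp (- (1 / t)) * (real k * t ^ (k - Suc 0)))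
          / (t ^ k * t ^ k)) (at t)"
      using 1 by (auto intro!: derivative_eq_intros simp: power2_eq_square)
    also have "(exp (- (1 / t)) * (1 / t\<^sup>2) * t ^ k - exp (- (1 / t)) * (real k * t ^ (k - Suc 0)))
          / (t ^ k * t ^ k) = exp (- (1 / t)) / (t ^ k * t\<^sup>2) - real k * (exp (- (1 / t)) / (t ^ k * t))"
      unfolding e by (rule alg) (use 1 in simp)
    also have "\<dots> = exp_recip (k + 2) t - k * exp_recip (k + 1) t"
      unfolding exp_recip_def power_add power_one_right if_P[OF 1] ..
    finally have "((\<lambda>t. exp (- (1 / t)) / t ^ k) has_real_derivative
        (exp_recip (k + 2) t - k * exp_recip (k + 1) t)) (at t)" .
    then show ?thesis
      by (rule has_field_derivative_transform_within_open[of _ _ _ "{0<..}"])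
        (use 1 in \<open>auto simp: exp_recip_def\<close>)
  next
    case 2
    have "((\<lambda>t. 0) has_real_derivative (exp_recip (k + 2) t - k * exp_recip (k + 1) t)) (at t)"
      using 2 by (simp add: exp_recip_def)
    then show ?thesis
      by (rule has_field_derivative_transform_within_open[of _ _ _ "{..<0}"])
        (use 2 in \<open>auto simp: exp_recip_def\<close>)
  next
    case 3
    \<comment> \<open>At the origin the difference quotient is the next member of the family, which
      tends to 0.\<close>
    have "eventually (\<lambda>t. exp_recip (Suc k) t = (exp_recip k t - exp_recip k 0) / (t - 0)) (at 0)"
      by (auto simp: exp_recip_def eventually_at_filter)
    then have "((\<lambda>t. (exp_recip k t - exp_recip k 0) / (t - 0)) \<longlongrightarrow> 0) (at 0)"
      by (rule Lim_transform_eventually[OF exp_recip_tendsto_0])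
    with 3 show ?thesis
      by (simp add: has_field_derivative_iff exp_recip_def)
  qed
qed

text \<open>An algebra of functions that is closed under partial derivatives, hence consists of smooth functions.\<close>
inductive bump_alg :: "(real^'n::finite \<Rightarrow> real) \<Rightarrow> bool" where
  const: "bump_alg (\<lambda>x. a)"
| coord: "bump_alg (\<lambda>x. x $ i)"
| add: "bump_alg f \<Longrightarrow> bump_alg g \<Longrightarrow> bump_alg (\<lambda>x. f x + g x)"
| mult: "bump_alg f \<Longrightarrow> bump_alg g \<Longrightarrow> bump_alg (\<lambda>x. f x * g x)"
| exp_recip: "bump_alg f \<Longrightarrow> bump_alg (\<lambda>x. exp_recip k (f x))"

text \<open>Total derivatives are carried through the induction because the chain rule needs them;
  evaluating at axis vectors later reads off the partial derivatives.\<close>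

lemma bump_alg_derivative:
  "bump_alg f \<Longrightarrow> \<exists>f'. (\<forall>i. bump_alg (f' i)) \<and>
     (\<forall>x. (f has_derivative (\<lambda>h. \<Sum>i\<in>UNIV. h $ i * f' i x)) (at x))"
proof (induction rule: bump_alg.induct)
  case (const a)
  show ?case
    by (rule exI[of _ "\<lambda>i x. 0"]) (auto intro: bump_alg.const)
next
  case (coord i)
  have "((\<lambda>x. x $ i) has_derivative (\<lambda>h. h $ i)) (at x)" for x
    by (intro bounded_linear_imp_has_derivative bounded_linear_vec_nth)
  then show ?case
    by (intro exI[of _ "\<lambda>j x. if i = j then 1 else 0"])
      (auto intro: bump_alg.const simp: if_distrib sum.delta cong: if_cong)
next
  case (add f g)
  then obtain f' g' where f': "\<And>i. bump_alg (f' i)" "\<And>i. bump_alg (g' i)"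
    and d: "\<And>x. (f has_derivative (\<lambda>h. \<Sum>i\<in>UNIV. h $ i * f' i x)) (at x)"
      "\<And>x. (g has_derivative (\<lambda>h. \<Sum>i\<in>UNIV. h $ i * g' i x)) (at x)"
    by blast
  have "((\<lambda>x. f x + g x) has_derivative (\<lambda>h. \<Sum>i\<in>UNIV. h $ i * (f' i x + g' i x))) (at x)" for x
    using has_derivative_add[OF d] by (simp add: distrib_left sum.distrib)
  then show ?case
    using f' by (intro exI[of _ "\<lambda>i x. f' i x + g' i x"]) (auto intro: bump_alg.intros)
next
  case (mult f g)
  then obtain f' g' where f': "\<And>i. bump_alg (f' i)" "\<And>i. bump_alg (g' i)"
    and d: "\<And>x. (f has_derivative (\<lambda>h. \<Sum>i\<in>UNIV. h $ i * f' i x)) (at x)"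
      "\<And>x. (g has_derivative (\<lambda>h. \<Sum>i\<in>UNIV. h $ i * g' i x)) (at x)"
    by blast
  have "((\<lambda>x. f x * g x) has_derivative
      (\<lambda>h. \<Sum>i\<in>UNIV. h $ i * (f x * g' i x + f' i x * g x))) (at x)" for x
    using has_derivative_mult[OF d]
    by (simp add: algebra_simps sum.distrib sum_distrib_left)
  then show ?case
    using f' mult.hyps
    by (intro exI[of _ "\<lambda>i x. f x * g' i x + f' i x * g x"]) (auto intro!: bump_alg.intros)
next
  case (exp_recip f k)
  then obtain f' where f': "\<And>i. bump_alg (f' i)"
    and d: "\<And>x. (f has_derivative (\<lambda>h. \<Sum>i\<in>UNIV. h $ i * f' i x)) (at x)"
    by blast
  let ?e = "\<lambda>t. exp_recip (k + 2) t + (- real k) * exp_recip (k + 1) t"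
  have "((\<lambda>x. exp_recip k (f x)) has_derivative (\<lambda>h. \<Sum>i\<in>UNIV. h $ i * (?e (f x) * f' i x))) (at x)" for x
  proof -
    have "(exp_recip k has_derivative (\<lambda>h. ?e (f x) * h)) (at (f x))"
      using exp_recip_has_derivative[of k "f x"] by (simp add: has_field_derivative_def)
    from diff_chain_at[OF d this] show ?thesis
      by (simp add: o_def sum_distrib_left mult.left_commute)
  qed
  moreover have "bump_alg (\<lambda>x. ?e (f x) * f' i x)" for i
    using f' exp_recip.hyps by (intro bump_alg.intros)
  ultimately show ?case
    by (intro exI[of _ "\<lambda>i x. ?e (f x) * f' i x"]) blast
qed

lemma bump_alg_smooth:
  assumes "bump_alg f"
  shows "smooth_on UNIV f"
proof -
  have "bump_alg (Dlist xs f)" for xs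
  proof (induction xs)
    case (Cons i xs)
    then obtain f' where f': "\<And>i. bump_alg (f' i)"
      and d: "\<And>x. (Dlist xs f has_derivative (\<lambda>h. \<Sum>i\<in>UNIV. h $ i * f' i x)) (at x)"
      using bump_alg_derivative by blast
    have "Dlist (i # xs) f = f' i"
      by (simp add: fun_eq_iff frechet_derivative_at[OF d, symmetric] axis_def
          if_distrib[of "\<lambda>z. z * _"] sum.delta cong: if_cong)
    then show ?case using f' by simp
  qed (use assms in simp)
  then show ?thesis
    unfolding smooth_on_def differentiable_on_def
    by (meson bump_alg_derivative differentiableI differentiable_at_withinI)
qed

lemma ex_bump:
  assumes "\<epsilon> > 0"
  obtains \<phi> :: "real^'n::finite \<Rightarrow> real"
  where "test_fun UNIV \<phi>" "\<And>x. \<phi> x \<ge> 0" "\<And>x. \<phi> x > 0 \<longleftrightarrow> norm x < \<epsilon>"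
proof
  \<comment> \<open>Squaring the norm makes the argument a polynomial in the coordinates, which
    keeps the function in \<open>bump_alg\<close>.\<close>
  let ?\<phi> = "\<lambda>x::real^'n. exp_recip 0 (\<epsilon>\<^sup>2 - (norm x)\<^sup>2)"
  have sum: "bump_alg (\<lambda>x. \<Sum>i\<in>I. x $ i * x $ i)" if "finite I" for I :: "'n set"
    using that
  proof induction
    case (insert i I)
    then show ?case by (simp add: bump_alg.add bump_alg.mult bump_alg.coord)
  qed (simp add: bump_alg.const)
  have "?\<phi> = (\<lambda>x. exp_recip 0 (\<epsilon>\<^sup>2 + (-1) * (\<Sum>i\<in>UNIV. x $ i * x $ i)))"
    by (simp add: power2_norm_eq_inner inner_vec_def)
  moreover have "bump_alg \<dots>"
    using sum by (intro bump_alg.intros) auto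
  ultimately have smooth: "smooth_on UNIV ?\<phi>"
    using bump_alg_smooth by metis
  show iff: "?\<phi> x > 0 \<longleftrightarrow> norm x < \<epsilon>" for x
  proof -
    have "(norm x)\<^sup>2 < \<epsilon>\<^sup>2 \<longleftrightarrow> norm x < \<epsilon>"
      using assms by (metis norm_ge_zero power2_less_imp_less power_strict_mono pos2 less_imp_le)
    then show ?thesis by (simp add: exp_recip_def)
  qed
  have "tsupp ?\<phi> \<subseteq> cball 0 \<epsilon>"
    unfolding tsupp_def
  proof (rule closure_minimal)
    show "{x. ?\<phi> x \<noteq> 0} \<subseteq> cball 0 \<epsilon>"
    proof safe
      fix x :: "real^'n"
      assume "?\<phi> x \<noteq> 0"
      then have "?\<phi> x > 0" by (auto simp: exp_recip_def split: if_splits)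
      with iff[of x] show "x \<in> cball 0 \<epsilon>" by simp
    qed
  qed simp
  then have "compact (tsupp ?\<phi>)"
    using bounded_subset[OF bounded_cball] by (auto simp: compact_eq_bounded_closed tsupp_def)
  with smooth show "test_fun UNIV ?\<phi>"
    by (simp add: test_fun_def)
  show "?\<phi> x \<ge> 0" for x
    by (simp add: exp_recip_def)
qed

subsection \<open>Weighted homogeneity\<close>

text \<open>Monomials are multiplicative, so Artin's argument for the independence of characters applies.\<close>
lemma monomials_independent:
  fixes d :: "('n::finite \<Rightarrow> nat) \<Rightarrow> real"
  assumes "finite F" "\<And>x. (\<Sum>\<alpha>\<in>F. d \<alpha> * (\<Prod>i\<in>UNIV. x i ^ \<alpha> i)) = 0" "\<beta> \<in> F"
  shows "d \<beta> = 0"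
  using assms
proof (induction F arbitrary: d \<beta> rule: finite_induct)
  case (insert \<gamma> F)
  let ?m = "\<lambda>\<alpha> x. \<Prod>i\<in>UNIV. (x i :: real) ^ \<alpha> i"
  have F: "d \<alpha> = 0" if "\<alpha> \<in> F" for \<alpha>
  proof -
    have "\<alpha> \<noteq> \<gamma>" using insert.hyps that by blast
    then obtain i where i: "\<alpha> i \<noteq> \<gamma> i" by auto
    \<comment> \<open>Doubling a coordinate in which the exponents differ separates the two
      monomials.\<close>
    define y where "y = (\<lambda>j. if j = i then 2 else (1::real))"
    have m: "?m \<delta> y = 2 ^ \<delta> i" for \<delta>
      unfolding y_def by (simp add: if_distrib[of "\<lambda>x. x ^ _"] prod.delta cong: if_cong)
    \<comment> \<open>Multiplying the relation at x by the \<gamma>-monomial of y and subtracting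
      the relation at the product of y and x cancels the \<gamma> term, leaving a shorter
      relation.\<close>
    have "(\<Sum>\<alpha>\<in>F. (d \<alpha> * (?m \<gamma> y - ?m \<alpha> y)) * ?m \<alpha> x) = 0" for x
    proof -
      have "(\<Sum>\<alpha>\<in>F. (d \<alpha> * (?m \<gamma> y - ?m \<alpha> y)) * ?m \<alpha> x)
          = (\<Sum>\<alpha>\<in>insert \<gamma> F. (d \<alpha> * (?m \<gamma> y - ?m \<alpha> y)) * ?m \<alpha> x)"
        using insert.hyps by simp
      also have "\<dots> = ?m \<gamma> y * (\<Sum>\<alpha>\<in>insert \<gamma> F. d \<alpha> * ?m \<alpha> x)
          - (\<Sum>\<alpha>\<in>insert \<gamma> F. d \<alpha> * ?m \<alpha> (\<lambda>i. y i * x i))"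
        unfolding sum_distrib_left sum_subtractf[symmetric]
        by (rule sum.cong) (auto simp: power_mult_distrib prod.distrib algebra_simps)
      also have "\<dots> = 0" using insert.prems by simp
      finally show ?thesis .
    qed
    from insert.IH[OF this that] have "d \<alpha> * (2 ^ \<gamma> i - 2 ^ \<alpha> i) = 0"
      unfolding m .
    with i show ?thesis by simp
  qed
  have "d \<gamma> = 0"
    using insert.prems(1)[of "\<lambda>_. 1"] F insert.hyps by simp
  with F insert.prems show ?case by auto
qed simp

text \<open>Comparing coefficients in the homogeneity identity at t = 2 gives \<kappa> = 2^k for
  each occurring multi-index.\<close>

lemma weighted_homogeneous_imp_scaling:
  fixes A :: "('n::finite \<Rightarrow> nat) \<Rightarrow> real^'N::finite^'M::finite"
  assumes "diff_op A" "weighted_homogeneous A"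
  obtains a :: "'n \<Rightarrow> real" and \<kappa>
  where "\<And>i. a i > 1" "\<And>\<alpha>. A \<alpha> \<noteq> 0 \<Longrightarrow> (\<Prod>i\<in>UNIV. a i ^ \<alpha> i) = \<kappa>"
proof -
  obtain w :: "real^'n" and k where w: "\<And>i. w $ i > 0"
    and h: "\<And>t x. t > 0 \<Longrightarrow> symbol A (\<chi> i. t powr (w $ i) * x $ i) = t powr k *\<^sub>R symbol A x"
    using assms(2) unfolding weighted_homogeneous_def by blast
  \<comment> \<open>Taking t > 1 together with positive weights makes every factor exceed 1.\<close>
  define a where "a i = 2 powr (w $ i)" for i
  let ?F = "{\<alpha>. A \<alpha> \<noteq> 0}"
  let ?m = "\<lambda>\<alpha> x. \<Prod>i\<in>UNIV. (x i :: real) ^ \<alpha> i"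
  have "?m \<alpha> a = 2 powr k" if "A \<alpha> \<noteq> 0" for \<alpha>
  proof -
    \<comment> \<open>A nonzero matrix entry reduces the comparison to real coefficients.\<close>
    have "\<exists>q j. A \<alpha> $ q $ j \<noteq> 0"
      using that by (auto simp: vec_eq_iff)
    then obtain q j where qj: "A \<alpha> $ q $ j \<noteq> 0" by blast
    let ?d = "\<lambda>\<beta>. (?m \<beta> a - 2 powr k) * A \<beta> $ q $ j"
    have zero: "(\<Sum>\<beta>\<in>?F. ?d \<beta> * ?m \<beta> x) = 0" for x
    proof -
      have "(\<Sum>\<beta>\<in>?F. ?m \<beta> (\<lambda>i. a i * x i) * A \<beta> $ q $ j)
          = symbol A (\<chi> i. 2 powr (w $ i) * (\<chi> i. x i) $ i) $ q $ j"
        by (simp add: symbol_def a_def)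
      also have "\<dots> = 2 powr k * (\<Sum>\<beta>\<in>?F. ?m \<beta> x * A \<beta> $ q $ j)"
        by (subst h) (simp_all add: symbol_def)
      finally have "0 = (\<Sum>\<beta>\<in>?F. ?m \<beta> (\<lambda>i. a i * x i) * A \<beta> $ q $ j)
          - 2 powr k * (\<Sum>\<beta>\<in>?F. ?m \<beta> x * A \<beta> $ q $ j)"
        by simp
      also have "\<dots> = (\<Sum>\<beta>\<in>?F. ?d \<beta> * ?m \<beta> x)"
        unfolding sum_distrib_left sum_subtractf[symmetric] power_mult_distrib prod.distrib
        by (rule sum.cong) (simp_all add: algebra_simps)
      finally show ?thesis ..
    qed
    have "?d \<alpha> = 0"
      by (rule monomials_independent[OF _ zero]) (use assms(1) that in \<open>simp_all add: diff_op_def\<close>)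
    with qj show ?thesis by simp
  qed
  moreover have "a i > 1" for i
    using w by (simp add: a_def)
  ultimately show ?thesis using that by blast
qed

subsection \<open>Test functions and regular distributions\<close>

lemma test_fun_continuous: "test_fun \<Omega> \<phi> \<Longrightarrow> continuous_on UNIV \<phi>"
  by (simp add: test_fun_def smooth_on_continuous)

lemma not_in_tsupp: "x \<notin> tsupp \<phi> \<Longrightarrow> \<phi> x = 0"
  using closure_subset[of "{x. \<phi> x \<noteq> 0}"] by (auto simp: tsupp_def)

text \<open>Makes the suprema in \<open>is_distribution\<close> true upper bounds, since a
  conditional supremum says nothing about an unbounded set.\<close>

lemma test_fun_bounded:
  assumes "test_fun \<Omega> \<phi>"
  shows "bdd_above (range (\<lambda>x. \<bar>\<phi> x\<bar>))"
proof -
  have "compact (\<phi> ` tsupp \<phi>)"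
    using assms continuous_on_subset[OF test_fun_continuous[OF assms] subset_UNIV]
    by (intro compact_continuous_image) (simp_all add: test_fun_def)
  then have "bounded (\<phi> ` tsupp \<phi>)"
    by (rule compact_imp_bounded)
  then obtain B where B: "\<forall>y\<in>\<phi> ` tsupp \<phi>. \<bar>y\<bar> \<le> B"
    unfolding bounded_real ..
  show ?thesis
  proof (rule bdd_aboveI2)
    \<comment> \<open>If the support is empty, \<open>B\<close> is unconstrained and may be
      negative.\<close>
    show "\<bar>\<phi> x\<bar> \<le> max B 0" for x
      using B not_in_tsupp[of x \<phi>] by (cases "x \<in> tsupp \<phi>") (simp_all add: le_max_iff_disj)
  qed
qed

lemma abs_le_SUP_test_fun:
  "test_fun \<Omega> \<phi> \<Longrightarrow> \<bar>\<phi> x\<bar> \<le> (SUP x. \<bar>\<phi> x\<bar>)"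
  by (rule cSUP_upper[OF UNIV_I test_fun_bounded])

lemma integrable_mult_test_fun:
  assumes "continuous_on UNIV g" "test_fun \<Omega> \<phi>"
  shows "integrable lborel (\<lambda>x. g x * \<phi> x)"
proof -
  have "integrable lborel (\<lambda>x. indicator (tsupp \<phi>) x *\<^sub>R (g x * \<phi> x))"
    using assms test_fun_continuous[OF assms(2)]
    by (intro borel_integrable_compact continuous_on_mult)
      (auto simp: test_fun_def intro: continuous_on_subset)
  also have "(\<lambda>x. indicator (tsupp \<phi>) x *\<^sub>R (g x * \<phi> x)) = (\<lambda>x. g x * \<phi> x)"
    using not_in_tsupp[of _ \<phi>] by (simp add: indicator_def fun_eq_iff) blast
  finally show ?thesis .
qed

text \<open>The complement of the closed support is open, so the function vanishes near such a point
  and so do all its derivatives.\<close>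

lemma Dlist_eq_0_outside_tsupp: "x \<notin> tsupp f \<Longrightarrow> Dlist xs f x = 0"
proof (induction xs arbitrary: x)
  case Nil
  then show ?case by (simp add: not_in_tsupp)
next
  case (Cons i xs)
  have "((\<lambda>x. 0) has_derivative (\<lambda>h. 0)) (at x)" by simp
  then have "(Dlist xs f has_derivative (\<lambda>h. 0)) (at x)"
    by (rule has_derivative_transform_within_open[of _ _ _ _ "- tsupp f"])
      (use Cons in \<open>auto simp: tsupp_def\<close>)
  then show ?case by (simp add: frechet_derivative_at[symmetric])
qed

lemma test_fun_Dlist:
  assumes "test_fun \<Omega> \<phi>"
  shows "test_fun \<Omega> (Dlist xs \<phi>)"
proof -
  have "tsupp (Dlist xs \<phi>) \<subseteq> tsupp \<phi>"
    unfolding tsupp_def[of "Dlist xs \<phi>"]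
    by (rule closure_minimal) (use Dlist_eq_0_outside_tsupp[of _ \<phi>] in \<open>auto simp: tsupp_def\<close>)
  moreover have "closed (tsupp (Dlist xs \<phi>))" by (simp add: tsupp_def)
  ultimately show ?thesis
    using assms smooth_on_Dlist compact_Int_closed[of "tsupp \<phi>" "tsupp (Dlist xs \<phi>)"]
    by (auto simp: test_fun_def Int_absorb1)
qed

section \<open>Pull-backs of regular distributions and their decay\<close>

lemma continuous_nth:
  fixes g :: "real^'n::finite \<Rightarrow> real^'N::finite"
  shows "continuous_on S g \<Longrightarrow> continuous_on S (\<lambda>x. g x $ j)"
  by (intro continuous_intros)

lemma reg_dist_dil:
  fixes g :: "real^'n::finite \<Rightarrow> real^'N::finite"
  assumes "\<And>i. c i > 0" "continuous_on UNIV (\<lambda>x. g x $ j)" "continuous_on UNIV \<psi>"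
  shows "reg_dist (\<lambda>x. g (dil c b x)) j (\<lambda>x. \<psi> (dil c b x)) = reg_dist g j \<psi> / (\<Prod>i\<in>UNIV. c i)"
  unfolding reg_dist_def
  by (rule integral_dil[of c "\<lambda>x. g x $ j * \<psi> x" b, OF assms(1)])
    (intro borel_measurable_continuous_onI continuous_on_mult assms)

text \<open>Derivatives fall on the test function, so continuity of \<open>u\<close> is enough.
  Since \<kappa> is the same for all occurring \<alpha>, it factors out with the Jacobian, leaving a
  multiple of the original equation tested on \<psi>. This covers powers of the dilation as well as
  translations, for which \<kappa> = 1.\<close>

lemma dist_apply_dil:
  fixes A :: "('n::finite \<Rightarrow> nat) \<Rightarrow> real^'N::finite^'M::finite"
  assumes c: "\<And>i. c i > 0" "\<And>\<alpha>. A \<alpha> \<noteq> 0 \<Longrightarrow> (\<Prod>i\<in>UNIV. c i ^ \<alpha> i) = \<kappa>"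
    and u: "continuous_on UNIV u"
    and sol: "\<And>\<phi>. test_fun UNIV \<phi> \<Longrightarrow> dist_apply A (reg_dist u) k \<phi> = 0"
    and \<phi>: "test_fun UNIV \<phi>"
  shows "dist_apply A (reg_dist (\<lambda>x. u (dil c b x))) k \<phi> = 0"
proof -
  define \<psi> where "\<psi> x = \<phi> (dil (\<lambda>i. inverse (c i)) (\<chi> i. - (b $ i / c i)) x)" for x
  have c0: "c i \<noteq> 0" for i using c(1)[of i] by simp
  have \<psi>: "test_fun UNIV \<psi>"
    unfolding \<psi>_def by (rule test_fun_dil[OF \<phi>]) (simp add: c0)
  have \<phi>_eq: "\<phi> = (\<lambda>x. \<psi> (dil c b x))"
    by (simp add: \<psi>_def dil_inverse(1)[of c, OF c0])
  have "reg_dist (\<lambda>x. u (dil c b x)) j (Dlist (mlist \<alpha>) \<phi>)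
      = \<kappa> / (\<Prod>i\<in>UNIV. c i) * reg_dist u j (Dlist (mlist \<alpha>) \<psi>)" if "A \<alpha> \<noteq> 0" for \<alpha> j
  proof -
    have "Dlist (mlist \<alpha>) \<phi> = (\<lambda>x. \<kappa> * Dlist (mlist \<alpha>) \<psi> (dil c b x))"
      unfolding \<phi>_eq using \<psi> c(2)[OF that]
      by (subst Dlist_dil) (auto simp: test_fun_def prod_list_map_mlist)
    then have "reg_dist (\<lambda>x. u (dil c b x)) j (Dlist (mlist \<alpha>) \<phi>)
        = \<kappa> * reg_dist (\<lambda>x. u (dil c b x)) j (\<lambda>x. Dlist (mlist \<alpha>) \<psi> (dil c b x))"
      by (simp add: reg_dist_def mult.left_commute[of _ \<kappa>])
    also have "\<dots> = \<kappa> * (reg_dist u j (Dlist (mlist \<alpha>) \<psi>) / (\<Prod>i\<in>UNIV. c i))"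
      using c(1) continuous_nth[OF u] test_fun_continuous[OF test_fun_Dlist[OF \<psi>]]
      by (subst reg_dist_dil) auto
    finally show ?thesis by simp
  qed
  then have "dist_apply A (reg_dist (\<lambda>x. u (dil c b x))) k \<phi>
      = \<kappa> / (\<Prod>i\<in>UNIV. c i) * dist_apply A (reg_dist u) k \<psi>"
    unfolding dist_apply_def sum_distrib_left
    by (intro sum.cong refl) (simp add: mult_ac)
  with sol[OF \<psi>] show ?thesis by simp
qed

text \<open>A pointwise stand-in for Hoelder's inequality: where y > \<epsilon>, the nonpositive
  exponent 1 - p gives y^(1-p) \<le> \<epsilon>^(1-p).\<close>

lemma le_add_powr:
  fixes y :: real
  assumes "1 \<le> p" "\<epsilon> > 0" "y \<ge> 0"
  shows "y \<le> \<epsilon> + \<epsilon> powr (1 - p) * y powr p"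
proof (cases "y \<le> \<epsilon>")
  case True
  have "0 \<le> \<epsilon> powr (1 - p) * y powr p" by simp
  with True show ?thesis by linarith
next
  case False
  have "y = y powr (1 - p) * y powr p"
    using False assms by (simp add: powr_add[symmetric])
  also have "\<dots> \<le> \<epsilon> powr (1 - p) * y powr p"
    using False assms by (intro mult_right_mono powr_mono2') auto
  finally show ?thesis using assms(2) by linarith
qed

text \<open>The Jacobian divides the integral of |f|^p by the product of the c_i, and its p-th root
  is the decay. The remaining constant depends on \<open>f\<close>, p and \<open>K\<close> but not
  on \<open>c\<close>, and \<phi> enters through \<open>B\<close> alone; this yields both a
  geometric series and a distribution bound.\<close>

lemma reg_dist_dil_bound:
  fixes f :: "real^'n::finite \<Rightarrow> real^'N::finite"
  assumes "1 \<le> p" and f: "continuous_on UNIV f" "integrable lborel (\<lambda>x. norm (f x) powr p)"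
    and c: "\<And>i. c i > 0" and \<phi>: "test_fun UNIV \<phi>" "tsupp \<phi> \<subseteq> K" "compact K"
    and B: "\<And>x. \<bar>\<phi> x\<bar> \<le> B"
  shows "\<bar>reg_dist (\<lambda>x. f (dil c b x)) j \<phi>\<bar>
    \<le> B * (\<Prod>i\<in>UNIV. c i) powr (- 1 / p) * (measure lborel K + (LINT x|lborel. norm (f x) powr p))"
proof -
  define S where "S = (\<Prod>i\<in>UNIV. c i)"
  (* This choice balances the two terms of le_add_powr after the change of variables. *)
  define \<epsilon> where "\<epsilon> = S powr (- 1 / p)"
  have S: "S > 0" unfolding S_def using c by (simp add: prod_pos)
  then have \<epsilon>: "\<epsilon> > 0" by (simp add: \<epsilon>_def)
  have B0: "B \<ge> 0" using B[of 0] by linarith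
  define N where "N x = norm (f x) powr p" for x
  have [measurable]: "N \<in> borel_measurable borel"
    using f(2) unfolding N_def by measurable
  have N: "integrable lborel (\<lambda>x. N (dil c b x))" "(LINT x|lborel. N (dil c b x)) = (LINT x|lborel. N x) / S"
    using f(2) c unfolding S_def by (auto simp: integrable_dil_iff integral_dil N_def[symmetric])
  have K: "integrable lborel (indicator K :: _ \<Rightarrow> real)"
    using \<phi>(3) emeasure_compact_finite[of K] borel_compact[of K]
    by (intro integrable_real_indicator) simp_all
  have "\<bar>reg_dist (\<lambda>x. f (dil c b x)) j \<phi>\<bar> \<le> (LINT x|lborel. \<bar>f (dil c b x) $ j * \<phi> x\<bar>)"
    unfolding reg_dist_def by (rule integral_abs_bound)
  also have "\<dots> \<le> (LINT x|lborel. B * (\<epsilon> * indicator K x + \<epsilon> powr (1 - p) * N (dil c b x)))"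
  proof (rule integral_mono)
    have "continuous_on UNIV (\<lambda>x. f (dil c b x) $ j)"
      using continuous_on_compose2[OF f(1) continuous_on_dil] by (intro continuous_nth) auto
    then show "integrable lborel (\<lambda>x. \<bar>f (dil c b x) $ j * \<phi> x\<bar>)"
      by (intro integrable_abs integrable_mult_test_fun[OF _ \<phi>(1)])
    show "integrable lborel (\<lambda>x. B * (\<epsilon> * indicator K x + \<epsilon> powr (1 - p) * N (dil c b x)))"
      using K N(1) by simp
    fix x
    show "\<bar>f (dil c b x) $ j * \<phi> x\<bar> \<le> B * (\<epsilon> * indicator K x + \<epsilon> powr (1 - p) * N (dil c b x))"
    proof (cases "x \<in> K")
      case True
      have "\<bar>f (dil c b x) $ j\<bar> \<le> \<epsilon> + \<epsilon> powr (1 - p) * N (dil c b x)"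
        unfolding N_def using le_add_powr[OF assms(1) \<epsilon> norm_ge_zero] component_le_norm_cart
        by (rule order.trans[rotated])
      with B[of x] have "\<bar>f (dil c b x) $ j\<bar> * \<bar>\<phi> x\<bar> \<le> (\<epsilon> + \<epsilon> powr (1 - p) * N (dil c b x)) * B"
        by (intro mult_mono) auto
      with True show ?thesis by (simp add: abs_mult mult.commute)
    next
      case False
      then have "\<phi> x = 0" using \<phi>(2) not_in_tsupp by blast
      then show ?thesis using B0 \<epsilon> by (simp add: N_def)
    qed
  qed
  also have "\<dots> = B * (\<epsilon> * measure lborel K + \<epsilon> powr (1 - p) / S * (LINT x|lborel. N x))"
    using K N by simp
  \<comment> \<open>This is \<epsilon>^p = 1/S rearranged.\<close>
  also have "\<epsilon> powr (1 - p) / S = \<epsilon>"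
  proof -
    have "\<epsilon> powr (1 - p) / S = S powr ((- 1 / p) * (1 - p)) * S powr (- 1)"
      using S by (simp only: \<epsilon>_def powr_powr powr_neg_one divide_inverse mult_1)
    also have "\<dots> = S powr ((- 1 / p) * (1 - p) - 1)"
      by (simp only: powr_add[symmetric] diff_conv_add_uminus)
    also have "(- 1 / p) * (1 - p) - 1 = - 1 / p"
      using assms(1) by (simp add: field_simps)
    finally show ?thesis by (simp add: \<epsilon>_def)
  qed
  finally show ?thesis
    by (simp add: \<epsilon>_def S_def N_def[abs_def] algebra_simps)
qed

text \<open>If \<open>h 0\<close> were nonzero, a bump positive only where \<open>h\<close> keeps
  the sign of \<open>h 0\<close> would give a nonzero integral.\<close>

lemma weakly_zero_imp_zero_at_0:
  fixes h :: "real^'n::finite \<Rightarrow> real"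
  assumes h: "continuous_on UNIV h"
    and zero: "\<And>\<phi>. test_fun UNIV \<phi> \<Longrightarrow> (LINT x|lborel. h x * \<phi> x) = 0"
  shows "h 0 = 0"
proof (rule ccontr)
  assume h0: "h 0 \<noteq> 0"
  \<comment> \<open>The factor \<open>h 0\<close> makes the value at 0 a positive square, avoiding a
    case split on the sign.\<close>
  define g where "g x = h 0 * h x" for x
  have g: "continuous_on UNIV g" "g 0 > 0"
    using h h0 by (auto simp: g_def[abs_def] zero_less_mult_iff intro: continuous_intros)
  have "open {x. g x > 0}"
    using g(1) by (intro open_Collect_less) auto
  with g(2) obtain \<delta> where \<delta>: "\<delta> > 0" "ball 0 \<delta> \<subseteq> {x. g x > 0}"
    by (metis mem_Collect_eq open_contains_ball)
  obtain \<phi> :: "real^'n \<Rightarrow> real" where \<phi>: "test_fun UNIV \<phi>" "\<And>x. \<phi> x \<ge> 0" "\<And>x. \<phi> x > 0 \<longleftrightarrow> norm x < \<delta>"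
    using ex_bump[OF \<delta>(1)] by metis
  have nonneg: "g x * \<phi> x \<ge> 0" for x
  proof (cases "norm x < \<delta>")
    case True
    then have "g x > 0" using \<delta>(2) by auto
    then show ?thesis using \<phi>(2) by simp
  next
    case False
    then have "\<phi> x = 0" using \<phi>(2,3)[of x] by linarith
    then show ?thesis by simp
  qed
  have ne: "g x * \<phi> x \<noteq> 0" if "x \<in> ball 0 \<delta>" for x
  proof -
    have "g x > 0" "\<phi> x > 0" using that \<delta>(2) \<phi>(3)[of x] by auto
    then show ?thesis by simp
  qed
  have "(LINT x|lborel. g x * \<phi> x) = 0"
    using zero[OF \<phi>(1)] by (simp add: g_def mult.assoc)
  then have "AE x in lborel. g x * \<phi> x = 0"
    using integral_nonneg_eq_0_iff_AE[OF integrable_mult_test_fun[OF g(1) \<phi>(1)]] nonneg by simp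
  then have "AE x in lborel. x \<notin> ball (0::real^'n) \<delta>"
    by (rule eventually_mono) (use ne in blast)
  then have "ball (0::real^'n) \<delta> \<in> null_sets lborel"
    by (simp add: AE_iff_null_sets)
  then have "negligible (ball (0::real^'n) \<delta>)"
    by (simp add: negligible_iff_null_sets null_sets_completionI)
  with \<delta>(1) show False
    using open_not_negligible[of "ball (0::real^'n) \<delta>"] by simp
qed

subsection \<open>Summing the dilates of a solution\<close>

text \<open>The conditions on \<open>u\<close> are ones that translates inherit: continuity,
  p-integrability and the weak equation.\<close>

lemma solution_vanishes_at_0:
  fixes A :: "('n::finite \<Rightarrow> nat) \<Rightarrow> real^'N::finite^'M::finite" and u :: "real^'n \<Rightarrow> real^'N"
    and a :: "'n \<Rightarrow> real"
  assumes p: "1 \<le> p" and hyp: "weakly_hypoelliptic A"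
    and a: "\<And>i. a i > 1" "\<And>\<alpha>. A \<alpha> \<noteq> 0 \<Longrightarrow> (\<Prod>i\<in>UNIV. a i ^ \<alpha> i) = \<kappa>"
    and u: "continuous_on UNIV u" "integrable lborel (\<lambda>x. norm (u x) powr p)"
    and sol: "\<And>k \<phi>. test_fun UNIV \<phi> \<Longrightarrow> dist_apply A (reg_dist u) k \<phi> = 0"
  shows "u 0 = 0"
proof -
  have a0: "a i > 0" for i using a(1)[of i] by simp
  \<comment> \<open>The m-fold iterate of the dilation is written as one diagonal map, so the
    invariance and decay lemmas apply to it directly.\<close>
  define v where "v m x = u (dil (\<lambda>i. a i ^ m) 0 x)" for m :: nat and x
  define s where "s = (\<Prod>i\<in>UNIV. a i)"
  define r where "r = s powr (- 1 / p)"
  have "s > 1" unfolding s_def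
    using a(1) prod_mono_strict[of _ UNIV "\<lambda>_. 1" a] less_1_prod[of UNIV a] by simp
  then have r: "0 < r" "r < 1"
    using p by (auto simp: r_def powr_less_one)
  have s: "s > 0" using \<open>s > 1\<close> by simp
  have v: "continuous_on UNIV (v m)" for m
    unfolding v_def using continuous_on_compose2[OF u(1) continuous_on_dil] by auto
  have solv: "dist_apply A (reg_dist (v m)) k \<phi> = 0" if "test_fun UNIV \<phi>" for m k \<phi>
    unfolding v_def
  proof (rule dist_apply_dil[OF _ _ u(1) sol that])
    show "(\<Prod>i\<in>UNIV. (a i ^ m) ^ \<alpha> i) = \<kappa> ^ m" if "A \<alpha> \<noteq> 0" for \<alpha>
      unfolding a(2)[OF that, symmetric] prod_power_distrib
      by (simp add: power_mult[symmetric] mult.commute)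
  qed (use a0 in auto)
  define C where "C K = measure lborel K + (LINT x|lborel. norm (u x) powr p)" for K :: "(real^'n) set"
  \<comment> \<open>\<open>K\<close> is kept apart from the support of \<phi> so that the constant
    is uniform over all test functions supported in \<open>K\<close>, as continuity of a
    distribution demands.\<close>
  have bound: "\<bar>reg_dist (v m) j \<phi>\<bar> \<le> (C K * (SUP x. \<bar>\<phi> x\<bar>)) * r ^ m"
    if "test_fun UNIV \<phi>" "tsupp \<phi> \<subseteq> K" "compact K" for m j \<phi> K
  proof -
    have "(\<Prod>i\<in>UNIV. a i ^ m) powr (- 1 / p) = r ^ m"
    proof -
      have "(\<Prod>i\<in>UNIV. a i ^ m) = s powr real m"
        using s by (simp add: s_def prod_power_distrib[symmetric] powr_realpow)
      then show ?thesis
        using s unfolding r_def by (simp only: powr_powr powr_power mult.commute)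
    qed
    then show ?thesis
      using reg_dist_dil_bound[OF p u, of "\<lambda>i. a i ^ m" \<phi> K "SUP x. \<bar>\<phi> x\<bar>" 0 j] a0 that
        abs_le_SUP_test_fun[OF that(1)]
      by (simp add: v_def[abs_def] C_def mult_ac)
  qed
  have summ: "summable (\<lambda>m. \<bar>reg_dist (v m) j \<phi>\<bar>)" if "test_fun UNIV \<phi>" for j \<phi>
  proof (rule summable_comparison_test')
    show "summable (\<lambda>m. (C (tsupp \<phi>) * (SUP x. \<bar>\<phi> x\<bar>)) * r ^ m)"
      using r by (intro summable_mult summable_geometric) auto
    show "norm \<bar>reg_dist (v m) j \<phi>\<bar> \<le> (C (tsupp \<phi>) * (SUP x. \<bar>\<phi> x\<bar>)) * r ^ m" for m
      using bound[OF that subset_refl] that by (simp add: test_fun_def)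
  qed
  note summ' = summable_rabs_cancel[OF summ]
  \<comment> \<open>Summation takes place after pairing with \<phi>: at the origin the pointwise
    series repeats \<open>u 0\<close> and diverges unless that value is 0.\<close>
  define G where "G j \<phi> = (\<Sum>m. reg_dist (v m) j \<phi>)" for j \<phi>
  have "is_distribution UNIV (G j)" for j
    unfolding is_distribution_def
  proof (intro conjI allI impI; (elim conjE)?)
    fix \<phi> \<psi> :: "real^'n \<Rightarrow> real" and c
    assume \<phi>: "test_fun UNIV \<phi>" and \<psi>: "test_fun UNIV \<psi>"
    have "reg_dist (v m) j (\<lambda>x. \<phi> x + \<psi> x) = reg_dist (v m) j \<phi> + reg_dist (v m) j \<psi>" for m
      unfolding reg_dist_def using v continuous_nth
      by (subst Bochner_Integration.integral_add[symmetric])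
        (auto intro!: integrable_mult_test_fun[OF _ \<phi>] integrable_mult_test_fun[OF _ \<psi>] simp: distrib_left)
    then show "G j (\<lambda>x. \<phi> x + \<psi> x) = G j \<phi> + G j \<psi>"
      unfolding G_def using suminf_add[OF summ'[OF \<phi>] summ'[OF \<psi>]] by simp
    have "reg_dist (v m) j (\<lambda>x. c * \<phi> x) = c * reg_dist (v m) j \<phi>" for m
      unfolding reg_dist_def by (simp add: mult.left_commute[of _ c])
    then show "G j (\<lambda>x. c * \<phi> x) = c * G j \<phi>"
      unfolding G_def using suminf_mult[OF summ'[OF \<phi>]] by simp
  next
    fix K :: "(real^'n) set"
    assume K: "compact K"
    have Nil: "{xs :: 'n list. length xs \<le> 0} = {[]}" by auto
    show "\<exists>B l. \<forall>\<phi>. test_fun UNIV \<phi> \<and> tsupp \<phi> \<subseteq> K \<longrightarrow>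
        \<bar>G j \<phi>\<bar> \<le> B * (\<Sum>xs\<in>{xs. length xs \<le> l}. SUP x. \<bar>Dlist xs \<phi> x\<bar>)"
    \<comment> \<open>G has order 0: the supremum of \<phi> itself suffices, and 1 / (1 - r) sums
      the geometric series.\<close>
    proof (intro exI[of _ "C K / (1 - r)"] exI[of _ "0::nat"] allI impI; elim conjE)
      fix \<phi> assume \<phi>: "test_fun UNIV \<phi>" "tsupp \<phi> \<subseteq> K"
      let ?S = "SUP x. \<bar>\<phi> x\<bar>"
      have "\<bar>G j \<phi>\<bar> \<le> (\<Sum>m. \<bar>reg_dist (v m) j \<phi>\<bar>)"
        unfolding G_def by (rule summable_rabs[OF summ[OF \<phi>(1)]])
      also have "\<dots> \<le> (\<Sum>m. (C K * ?S) * r ^ m)"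
        using bound[OF \<phi> K] summ[OF \<phi>(1)] r
        by (intro suminf_le summable_mult summable_geometric) auto
      also have "\<dots> = C K / (1 - r) * ?S"
        using r by (simp add: suminf_mult suminf_geometric summable_geometric)
      finally show "\<bar>G j \<phi>\<bar> \<le> C K / (1 - r) * (\<Sum>xs\<in>{xs. length xs \<le> 0}. SUP x. \<bar>Dlist xs \<phi> x\<bar>)"
        unfolding Nil by simp
    qed
  qed
  moreover have "dist_apply A G k \<phi> = 0" if \<phi>: "test_fun UNIV \<phi>" for k \<phi>
  proof -
    have sm: "summable (\<lambda>m. reg_dist (v m) j (Dlist (mlist \<alpha>) \<phi>))" for j \<alpha>
      using summ'[OF test_fun_Dlist[OF \<phi>]] .
    have "dist_apply A G k \<phi> = (\<Sum>m. dist_apply A (reg_dist (v m)) k \<phi>)"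
      unfolding dist_apply_def G_def
      by (simp add: suminf_mult[symmetric] suminf_sum[symmetric] summable_mult summable_sum sm)
    then show ?thesis using solv[OF \<phi>] by simp
  qed
  ultimately have "dist_solution UNIV A G"
    by (simp add: dist_solution_def vdist_def)
  then obtain f :: "real^'n \<Rightarrow> real^'N" where f: "\<And>j. smooth_on UNIV (\<lambda>x. f x $ j)"
    and Gf: "\<And>j \<phi>. test_fun UNIV \<phi> \<Longrightarrow> G j \<phi> = reg_dist f j \<phi>"
    using hyp unfolding weakly_hypoelliptic_def by (meson open_UNIV)
  have cf: "continuous_on UNIV (\<lambda>x. f x $ j)" for j
    using f smooth_on_continuous by blast
  have cfd: "continuous_on UNIV (\<lambda>x. f (dil a 0 x) $ j)" for j
    using continuous_on_compose2[OF cf continuous_on_dil] by auto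
  have "f 0 $ j - f (dil a 0 0) $ j - u 0 $ j = 0" for j
  proof (rule weakly_zero_imp_zero_at_0[of "\<lambda>x. f x $ j - f (dil a 0 x) $ j - u x $ j"])
    show "continuous_on UNIV (\<lambda>x. f x $ j - f (dil a 0 x) $ j - u x $ j)"
      by (intro continuous_on_diff cf cfd continuous_nth u)
    fix \<phi> :: "real^'n \<Rightarrow> real" assume \<phi>: "test_fun UNIV \<phi>"
    \<comment> \<open>Undoing one dilation in the test function turns the pairing with
      \<open>v (Suc m)\<close> into a pairing with \<open>v m\<close>, up to the Jacobian.\<close>
    define \<psi> where "\<psi> x = \<phi> (dil (\<lambda>i. inverse (a i)) 0 x)" for x
    have \<psi>: "test_fun UNIV \<psi>"
      unfolding \<psi>_def using a0 by (intro test_fun_dil[OF \<phi>]) (simp add: less_imp_neq[symmetric])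
    have "dil (\<lambda>i. inverse (a i)) 0 (dil a 0 x) = x" for x :: "real^'n"
      using a0 by (simp add: dil_def vec_eq_iff less_imp_neq[symmetric])
    then have \<phi>_eq: "\<phi> = (\<lambda>x. \<psi> (dil a 0 x))"
      by (simp add: \<psi>_def)
    have v0: "v 0 = u"
      by (simp add: v_def dil_def fun_eq_iff)
    have vSuc: "v (Suc m) = (\<lambda>x. v m (dil a 0 x))" for m
      by (simp add: v_def dil_def mult_ac fun_eq_iff)
    have "reg_dist (v (Suc m)) j \<phi> = reg_dist (v m) j \<psi> / s" for m
      unfolding s_def \<phi>_eq vSuc
      using reg_dist_dil[of a "v m" j \<psi> 0] a0 continuous_nth[OF v] test_fun_continuous[OF \<psi>] by simp
    \<comment> \<open>Splitting off the term m = 0 leaves the shifted series, which is the pull-back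
      of G by one dilation.\<close>
    then have "G j \<phi> = G j \<psi> / s + reg_dist u j \<phi>"
      unfolding G_def using suminf_split_head[OF summ'[OF \<phi>], of j] suminf_divide[OF summ'[OF \<psi>], of j s]
      by (simp add: v0)
    also have "G j \<psi> / s = reg_dist (\<lambda>x. f (dil a 0 x)) j \<phi>"
      unfolding Gf[OF \<psi>] s_def \<phi>_eq
      using reg_dist_dil[of a f j \<psi> 0] a0 cf test_fun_continuous[OF \<psi>] by simp
    finally have "reg_dist f j \<phi> - reg_dist (\<lambda>x. f (dil a 0 x)) j \<phi> - reg_dist u j \<phi> = 0"
      using Gf[OF \<phi>] by simp
    then show "(LINT x|lborel. (f x $ j - f (dil a 0 x) $ j - u x $ j) * \<phi> x) = 0"
      unfolding reg_dist_def left_diff_distrib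
      using cf cfd continuous_nth[OF u(1)]
      by (simp add: integrable_mult_test_fun[OF _ \<phi>])
  qed
  moreover have "dil a 0 0 = 0"
    by (simp add: dil_def vec_eq_iff)
  ultimately show ?thesis
    by (simp add: vec_eq_iff)
qed

section \<open>Conclusion by translation\<close>

lemma zero_in_sol_space:
  fixes A :: "('n::finite \<Rightarrow> nat) \<Rightarrow> real^'N::finite^'M::finite"
  shows "(\<lambda>x. 0) \<in> sol_space A"
proof -
  have "Dlist xs (\<lambda>x::real^'n. 0) = (\<lambda>x. 0)" for xs
    by (induction xs) auto
  then have "smooth_on UNIV (\<lambda>x::real^'n. 0)"
    by (simp add: smooth_on_def differentiable_on_def)
  then show ?thesis
    by (auto simp: sol_space_def dist_solution_def vdist_def is_distribution_def reg_dist_def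
        dist_apply_def intro!: exI[of _ 0])
qed

theorem mainTheorem6:
  fixes A :: "('n::finite \<Rightarrow> nat) \<Rightarrow> real^'N::finite^'M::finite" and p :: real
  assumes "1 \<le> p" and "diff_op A" and "weakly_hypoelliptic A" and "weighted_homogeneous A"
  shows "sol_space A \<inter> {f. Lp_fun p f} = {\<lambda>x. 0}"
proof
  show "{\<lambda>x. 0} \<subseteq> sol_space A \<inter> {f. Lp_fun p f}"
    by (simp add: zero_in_sol_space Lp_fun_def)
  show "sol_space A \<inter> {f. Lp_fun p f} \<subseteq> {\<lambda>x. 0}"
  proof
    fix u assume "u \<in> sol_space A \<inter> {f. Lp_fun p f}"
    then have smooth: "\<And>j. smooth_on UNIV (\<lambda>x. u x $ j)"
      and sol: "\<And>k \<phi>. test_fun UNIV \<phi> \<Longrightarrow> dist_apply A (reg_dist u) k \<phi> = 0"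
      and Lp: "integrable lborel (\<lambda>x. norm (u x) powr p)"
      by (auto simp: sol_space_def dist_solution_def Lp_fun_def)
    have "continuous_on UNIV (\<lambda>x. \<chi> j. u x $ j)"
      by (intro continuous_on_vec_lambda smooth_on_continuous smooth)
    then have u: "continuous_on UNIV u" by simp
    obtain a :: "'n \<Rightarrow> real" and \<kappa> where a: "\<And>i. a i > 1"
      "\<And>\<alpha>. A \<alpha> \<noteq> 0 \<Longrightarrow> (\<Prod>i\<in>UNIV. a i ^ \<alpha> i) = \<kappa>"
      using weighted_homogeneous_imp_scaling[OF assms(2,4)] by blast
    have "u b = 0" for b
    proof -
      \<comment> \<open>With unit factors \<open>dil\<close> is the translation by \<open>b\<close>,
        which carries the origin to the arbitrary point \<open>b\<close>.\<close>
      have "u (dil (\<lambda>i. 1) b 0) = 0"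
      proof (rule solution_vanishes_at_0[OF assms(1,3) a])
        show "continuous_on UNIV (\<lambda>x. u (dil (\<lambda>i. 1) b x))"
          using continuous_on_compose2[OF u continuous_on_dil] by auto
        show "integrable lborel (\<lambda>x. norm (u (dil (\<lambda>i. 1) b x)) powr p)"
          using Lp by (subst integrable_dil_iff) auto
        show "dist_apply A (reg_dist (\<lambda>x. u (dil (\<lambda>i. 1) b x))) k \<phi> = 0"
          if "test_fun UNIV \<phi>" for k \<phi>
          by (rule dist_apply_dil[OF _ _ u sol that]) auto
      qed
      then show ?thesis by (simp add: dil_def)
    qed
    then show "u \<in> {\<lambda>x. 0}" by auto
  qed
qed

end
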